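(* Consider the uniformized discrete-time Markov decision process (MDP) on state space $S$ described in the context, with traffic intensity $\rho=\sum_{i\in D}\lambda_i/\mu_i$. Suppose $\rho<1$. Then there exists a deterministic stationary policy $\theta$ whose long-run average cost $g_\theta(\mathbf{x})$ does not depend on the initial state $\mathbf{x}$ and is finite; that is, $g_\theta(\mathbf{x})=g_\theta<\infty$ for all $\mathbf{x}\in S$.
   Context: Network. Let $(V,E)$ be a finite connected graph. $D\subseteq V$ is a set of $d$ nodes called demand points, numbered $1,\dots,d$; the remaining nodes $N=V\setminus D$ are called intermediate stages, and there are $n=|N|$ of them. Jobs of type $i$ arrive at demand point $i\in D$ according to independent Poisson processes with rates $\lambda_i>0$, and wait in a first-come-first-served queue. A single server occupies one node at a time. At any time it may remain at its node or attempt to move to an adjacent node. If it remains at a demand point $i$ with at least one job present, jobs there are processed at rate $\mu_i>0$; if it attempts to move to an adjacent node, the switch occurs at rate $\tau>0$. Processing and switching times are exponential, independent of the arrivals, and can be interrupted at any time. Each job at demand point $i$ (waiting or being processed) incurs holding cost $c_i>0$ per unit time. MDP. The state space is $S=\{(v,(x_1,\dots,x_d)) : v\in V,\ x_i\in\mathbb{Z}_{\ge 0}\text{ for }i\in D\}$, where $v=v(\mathbf{x})$ is the server's node and $x_i$ is the number of jobs at demand point $i$ (including any in process). In state $\mathbf{x}$ the action set is $A_{\mathbf{x}}=\{v(\mathbf{x})\}\cup R(\mathbf{x})$, where $R(\mathbf{x})$ is the set of nodes adjacent to $v(\mathbf{x})$ (excluding $v(\mathbf{x})$). Time is scaled so that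 the uniformization step $\Delta=\left(\sum_{i\in D}\lambda_i+\max\{\mu_1,\dots,\mu_d,\tau\}\right)^{-1}$ equals $1$. In state $\mathbf{x}$ under action $a$, the one-step transition probabilities to states $\mathbf{y}\ne\mathbf{x}$ are: $\lambda_i$ if $\mathbf{y}$ is $\mathbf{x}$ with $x_i$ increased by one ($i\in D$); $\mu_i$ if $a=v(\mathbf{x})=i\in D$, $x_i\geq 1$ and $\mathbf{y}$ is $\mathbf{x}$ with $x_i$ decreased by one; $\tau$ if $a\in R(\mathbf{x})$ and $\mathbf{y}$ is $\mathbf{x}$ with the server's location changed to $a$; and $0$ otherwise. The remaining probability is that of staying in $\mathbf{x}$. The single-step cost is $f(\mathbf{x})=\sum_{i\in D}c_ix_i$. Policies. A policy may in general be history-dependent and randomized; a policy $\theta$ is deterministic and stationary if it always chooses a fixed action $\theta(\mathbf{x})\in A_{\mathbf{x}}$ in state $\mathbf{x}$. The long-run average cost of $\theta$ is $g_\theta(\mathbf{x})=\liminf_{T\to\infty}T^{-1}\,\mathbb{E}_\theta\left[\sum_{t=0}^{T-1}f(\mathbf{x}(t))\,\middle|\,\mathbf{x}(0)=\mathbf{x}\right]$, where $\mathbf{x}(t)$ is the state at time step $t$. *)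

theory Defs
  imports "Graph_Theory.Digraph_Component" "HOL-Probability.Probability"
begin

text \<open>
  The demand points form a subset of the nodes and serve as their own indices, so that the
  rates and costs, as well as the queue lengths, are functions on nodes of which only
  the values at demand points matter.
\<close>

record 'v server_network =
  network :: "'v pair_pre_digraph"
  demand_points :: "'v set"
  arrival_rate :: "'v \<Rightarrow> real"
  service_rate :: "'v \<Rightarrow> real"
  switch_rate :: real
  holding_cost :: "'v \<Rightarrow> real"

definition uniformization_step :: "'v server_network \<Rightarrow> real" where
  "uniformization_step N =
     inverse ((\<Sum>i\<in>demand_points N. arrival_rate N i)
              + Max (insert (switch_rate N) (service_rate N ` demand_points N)))"

definition traffic_intensity :: "'v server_network \<Rightarrow> real" where
  "traffic_intensity N = (\<Sum>i\<in>demand_points N. arrival_rate N i / service_rate N i)"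

text \<open>
  The locale \<open>pair_graph\<close> describes finite simple graphs, with each edge represented by both of
  its orientations. The last assumption is the choice of the time unit.
\<close>

locale uniformized_server_network =
  fixes N :: "'v server_network"
  assumes graph: "pair_graph (network N)"
    and connected: "Digraph_Component.connected (with_proj (network N))"
    and demand_points_subset: "demand_points N \<subseteq> pverts (network N)"
    and arrival_rate_pos: "\<And>i. i \<in> demand_points N \<Longrightarrow> arrival_rate N i > 0"
    and service_rate_pos: "\<And>i. i \<in> demand_points N \<Longrightarrow> service_rate N i > 0"
    and switch_rate_pos: "switch_rate N > 0"
    and holding_cost_pos: "\<And>i. i \<in> demand_points N \<Longrightarrow> holding_cost N i > 0"
    and time_scaled: "uniformization_step N = 1"

type_synonym 'v state = "'v \<times> ('v \<Rightarrow> nat)"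

definition states :: "'v server_network \<Rightarrow> 'v state set" where
  "states N = pverts (network N) \<times> (demand_points N \<rightarrow>\<^sub>E UNIV)"

definition adjacent_nodes :: "'v server_network \<Rightarrow> 'v state \<Rightarrow> 'v set" where
  "adjacent_nodes N s = {w. (fst s, w) \<in> parcs (network N) \<and> w \<noteq> fst s}"

definition actions :: "'v server_network \<Rightarrow> 'v state \<Rightarrow> 'v set" where
  "actions N s = {fst s} \<union> adjacent_nodes N s"

definition add_job :: "'v \<Rightarrow> 'v state \<Rightarrow> 'v state" where
  "add_job i s = (fst s, (snd s)(i := snd s i + 1))"

definition remove_job :: "'v \<Rightarrow> 'v state \<Rightarrow> 'v state" where
  "remove_job i s = (fst s, (snd s)(i := snd s i - 1))"

text \<open>
  Meaningful only for \<open>t \<noteq> s\<close>. The three kinds of transitions have different targets, and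
  arrivals at different demand points do as well, so at most one summand is nonzero.
\<close>

definition move_prob :: "'v server_network \<Rightarrow> 'v state \<Rightarrow> 'v \<Rightarrow> 'v state \<Rightarrow> real" where
  "move_prob N s a t =
     (\<Sum>i | i \<in> demand_points N \<and> t = add_job i s. arrival_rate N i)
   + (if a = fst s \<and> a \<in> demand_points N \<and> snd s a \<ge> 1 \<and> t = remove_job a s
      then service_rate N a else 0)
   + (if a \<in> adjacent_nodes N s \<and> t = (a, snd s) then switch_rate N else 0)"

definition transition_prob :: "'v server_network \<Rightarrow> 'v state \<Rightarrow> 'v \<Rightarrow> 'v state \<Rightarrow> real" where
  "transition_prob N s a t =
     (if t = s then 1 - (\<Sum>\<^sub>\<infinity>u\<in>-{s}. move_prob N s a u) else move_prob N s a t)"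

definition transition :: "'v server_network \<Rightarrow> 'v state \<Rightarrow> 'v \<Rightarrow> 'v state pmf" where
  "transition N s a = embed_pmf (transition_prob N s a)"

lemma (in uniformized_server_network)
  assumes "s \<in> states N" and "a \<in> actions N s"
  shows transition_prob_nonneg: "transition_prob N s a t \<ge> 0"
    and pmf_transition: "pmf (transition N s a) t = transition_prob N s a t"
proof -
  define D where "D = demand_points N"
  define m where "m = move_prob N s a"
  define B where "B = ((\<lambda>i. add_job i s) ` D \<union> {remove_job a s, (a, snd s)}) - {s}"
  interpret G: pair_graph "network N" by (rule graph)
  have finD: "finite D"
    unfolding D_def using demand_points_subset G.pair_finite_verts by (rule finite_subset)
  hence finB: "finite B" by (simp add: B_def)
  have m_nonneg: "m t \<ge> 0" for t
    unfolding m_def move_prob_def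
    using arrival_rate_pos service_rate_pos switch_rate_pos
    by (intro add_nonneg_nonneg sum_nonneg) (auto intro: less_imp_le)
  have m_0: "m t = 0" if "t \<notin> B" "t \<noteq> s" for t
  proof -
    have "{i. i \<in> demand_points N \<and> t = add_job i s} = {}"
      using that by (auto simp: B_def D_def)
    thus ?thesis using that by (auto simp: m_def move_prob_def B_def simp del: Collect_empty_eq)
  qed
  define p where "p = (if a = fst s \<and> a \<in> D \<and> snd s a \<ge> 1 then service_rate N a else 0)"
  define q where "q = (if a \<in> adjacent_nodes N s then switch_rate N else 0)"
  have p0: "p \<ge> 0" and q0: "q \<ge> 0"
    using service_rate_pos switch_rate_pos by (auto simp: p_def q_def D_def less_imp_le)
  have pq: "p + q \<le> Max (insert (switch_rate N) (service_rate N ` D))"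
  proof -
    have fin: "finite (insert (switch_rate N) (service_rate N ` D))" using finD by simp
    have 1: "switch_rate N \<le> Max (insert (switch_rate N) (service_rate N ` D))"
      using fin by (intro Max_ge) auto
    have 2: "service_rate N a \<le> Max (insert (switch_rate N) (service_rate N ` D))" if "a \<in> D"
      using fin that by (intro Max_ge) auto
    show ?thesis using 1 2 switch_rate_pos
      by (auto simp: p_def q_def adjacent_nodes_def)
  qed
  have unif: "(\<Sum>i\<in>D. arrival_rate N i) + Max (insert (switch_rate N) (service_rate N ` D)) = 1"
    using time_scaled unfolding uniformization_step_def D_def by (metis inverse_1 inverse_inverse_eq)
  have m_eq: "m t = (\<Sum>i\<in>D. if t = add_job i s then arrival_rate N i else 0)
      + (if t = remove_job a s then p else 0) + (if t = (a, snd s) then q else 0)" for t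
    unfolding m_def move_prob_def p_def q_def D_def[symmetric]
    using finD by (auto simp: sum.inter_filter)
  have "(\<Sum>t\<in>B. m t) = (\<Sum>i\<in>D. \<Sum>t\<in>B. if t = add_job i s then arrival_rate N i else 0)
      + (\<Sum>t\<in>B. if t = remove_job a s then p else 0) + (\<Sum>t\<in>B. if t = (a, snd s) then q else 0)"
    unfolding m_eq sum.distrib by (simp only: sum.swap[of _ D B])
  also have "\<dots> \<le> (\<Sum>i\<in>D. arrival_rate N i) + p + q"
    using finB p0 q0 arrival_rate_pos
    by (intro add_mono sum_mono) (auto simp: sum.delta D_def less_imp_le)
  also have "\<dots> \<le> 1" using unif pq by linarith
  finally have le1: "(\<Sum>t\<in>B. m t) \<le> 1" .
  have inf: "(\<Sum>\<^sub>\<infinity>u\<in>-{s}. m u) = (\<Sum>t\<in>B. m t)"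
  proof -
    have "(\<Sum>\<^sub>\<infinity>u\<in>-{s}. m u) = (\<Sum>\<^sub>\<infinity>u\<in>B. m u)"
      by (rule infsum_cong_neutral) (use m_0 in \<open>auto simp: B_def\<close>)
    thus ?thesis using finB by simp
  qed
  have tp: "transition_prob N s a t = (if t = s then 1 - (\<Sum>t\<in>B. m t) else m t)" for t
    unfolding transition_prob_def using inf by (simp add: m_def)
  show nonneg: "transition_prob N s a t \<ge> 0" for t
    unfolding tp using le1 m_nonneg by auto
  have sB: "s \<notin> B" by (simp add: B_def)
  have "(\<integral>\<^sup>+t. ennreal (transition_prob N s a t) \<partial>count_space UNIV)
      = (\<Sum>t\<in>insert s B. ennreal (transition_prob N s a t))"
    by (rule nn_integral_count_space') (use finB m_0 in \<open>auto simp: tp\<close>)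
  also have "\<dots> = ennreal (\<Sum>t\<in>insert s B. transition_prob N s a t)"
    using nonneg by (intro sum_ennreal) auto
  also have "(\<Sum>t\<in>insert s B. transition_prob N s a t) = 1"
  proof -
    have "(\<Sum>t\<in>B. transition_prob N s a t) = (\<Sum>t\<in>B. m t)"
      by (rule sum.cong) (use sB in \<open>auto simp: tp\<close>)
    thus ?thesis using finB sB by (simp add: tp)
  qed
  finally have "(\<integral>\<^sup>+t. ennreal (transition_prob N s a t) \<partial>count_space UNIV) = 1" by simp
  thus "pmf (transition N s a) t = transition_prob N s a t"
    unfolding transition_def using nonneg by (intro pmf_embed_pmf) auto
qed

definition step_cost :: "'v server_network \<Rightarrow> 'v state \<Rightarrow> real" where
  "step_cost N s = (\<Sum>i\<in>demand_points N. holding_cost N i * real (snd s i))"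

definition deterministic_stationary_policy ::
  "'v server_network \<Rightarrow> ('v state \<Rightarrow> 'v) \<Rightarrow> bool" where
  "deterministic_stationary_policy N \<theta> \<longleftrightarrow> (\<forall>s\<in>states N. \<theta> s \<in> actions N s)"

text \<open>
  The joint law of the first \<open>T\<close> states \<open>[x(0), \<dots>, x(T - 1)]\<close> of the Markov chain induced by
  \<open>\<theta>\<close>, started in \<open>x(0) = s\<close>.
\<close>

primrec trajectory ::
  "'v server_network \<Rightarrow> ('v state \<Rightarrow> 'v) \<Rightarrow> nat \<Rightarrow> 'v state \<Rightarrow> 'v state list pmf" where
  "trajectory N \<theta> 0 s = return_pmf []"
| "trajectory N \<theta> (Suc T) s =
     map_pmf ((#) s) (bind_pmf (transition N s (\<theta> s)) (trajectory N \<theta> T))"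

text \<open>
  Costs are nonnegative, so expectations and limits are taken in \<^typ>\<open>ennreal\<close>, where a
  divergent average cost has the value \<open>\<infinity>\<close>.
\<close>

definition expected_total_cost ::
  "'v server_network \<Rightarrow> ('v state \<Rightarrow> 'v) \<Rightarrow> nat \<Rightarrow> 'v state \<Rightarrow> ennreal" where
  "expected_total_cost N \<theta> T s =
     (\<integral>\<^sup>+ xs. ennreal (\<Sum>t<T. step_cost N (xs ! t)) \<partial>measure_pmf (trajectory N \<theta> T s))"

definition average_cost ::
  "'v server_network \<Rightarrow> ('v state \<Rightarrow> 'v) \<Rightarrow> 'v state \<Rightarrow> ennreal" where
  "average_cost N \<theta> s = liminf (\<lambda>T. expected_total_cost N \<theta> T s / of_nat T)"

end

theory Submission
  imports Defs
begin

text \<open>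
  A single Lyapunov function suffices: a function \<open>V \<ge> 0\<close> on the states and a state \<open>z\<close> such that in every
  state \<open>s \<noteq> z\<close> some action \<open>a\<close> satisfies \<open>f(s) + 1 + E\<^sub>a[V] \<le> V(s)\<close>, where \<open>E\<^sub>a[V]\<close> is the mean of \<open>V\<close>
  after one step (\<open>exists_lyapunov_function\<close>). The policy that chooses such actions is deterministic and
  stationary. Under it, \<open>V(s)\<close> bounds both the expected time and the expected cost until the first visit
  to \<open>z\<close>. Hence the expected costs from \<open>s\<close> and from \<open>z\<close> over a long horizon agree closely enough for
  their averages to have the same limit inferior, and this is finite because the drift in the single
  state \<open>z\<close> is finite (\<open>average_cost_constant\<close>). No renewal or ergodic theorem is needed.

  The main part of \<open>V\<close> is \<open>W\<^sup>2 + 2 W h\<close>, where \<open>W = \<Sum> x\<^sub>i / \<mu>\<^sub>i\<close> is the workload and \<open>h\<close> is the minimum over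
  the demand points \<open>j\<close> of the travel time from the server's node to \<open>j\<close> plus a debt that grows from zero
  to more than the longest travel time as queue \<open>j\<close> becomes short. The policy moves toward a minimizer
  \<open>j\<close>, or serves there. While the server travels, \<open>W\<close> drifts upward at rate \<open>\<rho>\<close>, but \<open>h\<close> drifts
  downward at rate at least \<open>1\<close>; while it serves, \<open>W\<close> drifts downward at rate \<open>1 - \<rho>\<close>, and \<open>h\<close> upward at rate at
  most \<open>(1 - \<rho>) / 2\<close>. In both cases the drift of \<open>W\<^sup>2 + 2 W h\<close> is at most \<open>- (1 - \<rho>) W\<close> up to a constant
  (\<open>energy_drift\<close>). Taking the minimum over \<open>j\<close> makes it unnecessary to remember the target.

  This leaves finitely many states of small workload, in which the server clears all queues and then
  returns to a fixed node. A bounded additional term, which reflects the number of moves that this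
  takes, gives a negative drift in these states as well, except in \<open>z\<close>, the empty system with the
  server at that node (\<open>emptying_potential\<close>).
\<close>

section \<open>Average costs of Markov chains with a Lyapunov function\<close>

text \<open>
  The error \<open>c / k + d k / T\<close> vanishes when first \<open>T\<close> and then \<open>k\<close> tends to infinity, and a fixed
  shift of the index does not change the limit inferior.
\<close>

lemma liminf_le_liminf_of_shifted_bound:
  fixes a b :: "nat \<Rightarrow> real"
  assumes bound: "\<And>T k. T \<ge> 1 \<Longrightarrow> k \<ge> 1 \<Longrightarrow> a T \<le> b (T + k) + c / real k + d * real k / real T"
  shows "liminf (\<lambda>T. ennreal (a T)) \<le> liminf (\<lambda>T. ennreal (b T))"
  unfolding le_Liminf_iff
proof (intro allI impI)
  fix y :: ennreal
  assume "y < liminf (\<lambda>T. ennreal (a T))"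
  then obtain w where w: "y < w" "w < liminf (\<lambda>T. ennreal (a T))"
    using dense by blast
  define y' w' where "y' = enn2real y" and "w' = enn2real w"
  have w_fin: "w < \<top>" using w(2) by (meson less_top_ennreal order_less_trans top_greatest order_less_le_trans)
  hence eqs: "y = ennreal y'" "w = ennreal w'"
    using w(1) by (auto simp: y'_def w'_def intro: order_less_trans)
  have y'_nonneg: "y' \<ge> 0" by (simp add: y'_def)
  have less: "y' < w'" using w(1) y'_nonneg by (simp add: eqs ennreal_less_iff)
  have "(\<lambda>k. c / real k) \<longlonglongrightarrow> 0" by real_asymp
  hence "\<forall>\<^sub>F k in sequentially. c / real k < (w' - y') / 2 \<and> k \<ge> 1"
    using less by (intro eventually_conj order_tendstoD(2) eventually_ge_at_top) auto
  then obtain k where k: "c / real k < (w' - y') / 2" "k \<ge> 1"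
    using eventually_happens by force
  have "(\<lambda>T. d * real k / real T) \<longlonglongrightarrow> 0" by real_asymp
  hence 1: "\<forall>\<^sub>F T in sequentially. d * real k / real T < (w' - y') / 2"
    using less by (intro order_tendstoD(2)) auto
  have 2: "\<forall>\<^sub>F T in sequentially. w < ennreal (a T)"
    using w(2) by (simp add: less_LiminfD)
  have "\<forall>\<^sub>F T in sequentially. y < ennreal (b (T + k))"
    using 1 2 eventually_ge_at_top[of 1]
  proof eventually_elim
    case (elim T)
    have "w' < a T"
      using elim(2) y'_nonneg less by (simp add: eqs ennreal_less_iff)
    hence "y' < b (T + k)"
      using bound[OF elim(3) k(2)] elim(1) k(1) by argo
    thus ?case using y'_nonneg by (simp add: eqs ennreal_less_iff)
  qed
  thus "\<forall>\<^sub>F T in sequentially. y < ennreal (b T)"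
    by (subst (asm) eventually_sequentially_seg)
qed

text \<open>
  A Markov chain with kernel \<open>K\<close> on a closed set \<open>S\<close> of states, which incurs the cost \<open>f s\<close> on each
  visit to \<open>s\<close>.
\<close>

locale cost_chain =
  fixes K :: "'s \<Rightarrow> 's pmf" and f :: "'s \<Rightarrow> ennreal" and S :: "'s set"
  assumes closed: "s \<in> S \<Longrightarrow> set_pmf (K s) \<subseteq> S"
begin

text \<open>The expected cost of the first \<open>T\<close> steps from \<open>s\<close>, by first-step analysis.\<close>

primrec total :: "nat \<Rightarrow> 's \<Rightarrow> ennreal" where
  "total 0 s = 0"
| "total (Suc T) s = f s + (\<integral>\<^sup>+ t. total T t \<partial>measure_pmf (K s))"

text \<open>
  The probability that the chain from \<open>s\<close> avoids \<open>z\<close> at the times \<open>0, \<dots>, k\<close>, by first-step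
  analysis.
\<close>

primrec not_hit :: "'s \<Rightarrow> nat \<Rightarrow> 's \<Rightarrow> ennreal" where
  "not_hit z 0 s = (if s = z then 0 else 1)"
| "not_hit z (Suc k) s = (if s = z then 0 else \<integral>\<^sup>+ t. not_hit z k t \<partial>measure_pmf (K s))"

lemma step_mono:
  assumes "s \<in> S" and "\<And>t. t \<in> S \<Longrightarrow> F t \<le> G t"
  shows "(\<integral>\<^sup>+ t. F t \<partial>measure_pmf (K s)) \<le> (\<integral>\<^sup>+ t. G t \<partial>measure_pmf (K s))"
  using assms closed by (intro nn_integral_mono_AE) (auto simp: AE_measure_pmf_iff)

lemma total_mono: "total T s \<le> total (Suc T) s"
proof (induction T arbitrary: s)
  case (Suc T)
  show ?case unfolding total.simps(2)[of "Suc T"] total.simps(2)[of "T" s]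
    by (intro add_left_mono nn_integral_mono Suc)
qed simp

lemma total_le_drift:
  assumes drift: "\<And>s. s \<in> S \<Longrightarrow> f s + (\<integral>\<^sup>+ t. V t \<partial>measure_pmf (K s)) \<le> V s + b"
    and "s \<in> S"
  shows "total T s \<le> V s + b * of_nat T"
  using \<open>s \<in> S\<close>
proof (induction T arbitrary: s)
  case (Suc T)
  have "total (Suc T) s \<le> f s + (\<integral>\<^sup>+ t. V t + b * of_nat T \<partial>measure_pmf (K s))"
    using Suc by (auto intro!: add_left_mono step_mono)
  also have "\<dots> = (f s + (\<integral>\<^sup>+ t. V t \<partial>measure_pmf (K s))) + b * of_nat T"
    by (simp add: nn_integral_add add.assoc)
  also have "\<dots> \<le> (V s + b) + b * of_nat T"
    using Suc.prems by (intro add_right_mono drift)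
  finally show ?case by (simp add: algebra_simps)
qed simp

text \<open>
  Off \<open>z\<close>, the drift condition bounds the expected cost before the first visit to \<open>z\<close> by \<open>V\<close>; the cost
  after this visit is at most that of a full horizon from \<open>z\<close>.
\<close>

lemma total_le_total_from:
  assumes drift: "\<And>s. s \<in> S \<Longrightarrow> s \<noteq> z \<Longrightarrow> f s + (\<integral>\<^sup>+ t. V t \<partial>measure_pmf (K s)) \<le> V s"
    and "s \<in> S"
  shows "total T s \<le> V s + total T z"
  using \<open>s \<in> S\<close>
proof (induction T arbitrary: s)
  case (Suc T)
  show ?case
  proof (cases "s = z")
    case False
    have "total (Suc T) s \<le> f s + (\<integral>\<^sup>+ t. V t + total T z \<partial>measure_pmf (K s))"
      using Suc by (auto intro!: add_left_mono step_mono)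
    also have "\<dots> = (f s + (\<integral>\<^sup>+ t. V t \<partial>measure_pmf (K s))) + total T z"
      by (simp add: nn_integral_add add.assoc)
    also have "\<dots> \<le> V s + total (Suc T) z"
      using Suc.prems False by (intro add_mono drift total_mono)
    finally show ?thesis .
  qed simp
qed simp

text \<open>
  Conversely, a path that visits \<open>z\<close> within \<open>k\<close> steps has at least \<open>T\<close> steps left after that visit, out
  of \<open>T + k\<close>.
\<close>

lemma total_from_le_total:
  "s \<in> S \<Longrightarrow> total T z \<le> total (T + k) s + not_hit z k s * total T z"
proof (induction k arbitrary: s)
  case (Suc k)
  show ?case
  proof (cases "s = z")
    case True
    have "total T z \<le> total (T + Suc k) z"
      by (rule lift_Suc_mono_le[of "\<lambda>T. total T z"]) (use total_mono in auto)
    thus ?thesis using True by (simp del: total.simps)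
  next
    case False
    have "total T z = (\<integral>\<^sup>+ t. total T z \<partial>measure_pmf (K s))" by simp
    also have "\<dots> \<le> (\<integral>\<^sup>+ t. total (T + k) t + not_hit z k t * total T z \<partial>measure_pmf (K s))"
      using Suc by (intro step_mono)
    also have "\<dots> = (\<integral>\<^sup>+ t. total (T + k) t \<partial>measure_pmf (K s)) + not_hit z (Suc k) s * total T z"
      using False by (simp add: nn_integral_add nn_integral_multc)
    also have "\<dots> \<le> total (T + Suc k) s + not_hit z (Suc k) s * total T z"
      by (intro add_right_mono) simp
    finally show ?thesis .
  qed
qed auto

lemma not_hit_le_1: "not_hit z k s \<le> 1"
proof (induction k arbitrary: s)
  case (Suc k)
  have "(\<integral>\<^sup>+ t. not_hit z k t \<partial>measure_pmf (K s)) \<le> (\<integral>\<^sup>+ t. 1 \<partial>measure_pmf (K s))"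
    by (intro nn_integral_mono Suc)
  thus ?case by simp
qed auto

text \<open>
  A Markov-type inequality: \<open>V s\<close> bounds the expected hitting time of \<open>z\<close>, hence \<open>k\<close> times the
  probability that it exceeds \<open>k\<close>.
\<close>

lemma not_hit_le_drift:
  assumes drift: "\<And>s. s \<in> S \<Longrightarrow> s \<noteq> z \<Longrightarrow> 1 + (\<integral>\<^sup>+ t. V t \<partial>measure_pmf (K s)) \<le> V s"
    and "s \<in> S"
  shows "of_nat k * not_hit z k s \<le> V s"
  using \<open>s \<in> S\<close>
proof (induction k arbitrary: s)
  case (Suc k)
  show ?case
  proof (cases "s = z")
    case False
    have "of_nat (Suc k) * not_hit z (Suc k) s
        = (\<integral>\<^sup>+ t. not_hit z k t + of_nat k * not_hit z k t \<partial>measure_pmf (K s))"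
      using False by (simp add: nn_integral_add nn_integral_cmult distrib_right)
    also have "\<dots> \<le> (\<integral>\<^sup>+ t. 1 + V t \<partial>measure_pmf (K s))"
      using Suc by (intro step_mono add_mono not_hit_le_1)
    also have "\<dots> = 1 + (\<integral>\<^sup>+ t. V t \<partial>measure_pmf (K s))"
      by (simp add: nn_integral_add)
    also have "\<dots> \<le> V s" using Suc.prems False by (intro drift)
    finally show ?thesis .
  qed simp
qed simp

text \<open>
  If \<open>V\<close> decreases on average by at least the cost plus one in every state but \<open>z\<close>, then the average
  cost is finite and the same from every state.
\<close>

theorem average_cost_constant:
  assumes z: "z \<in> S" and b: "b < \<infinity>" and V: "\<And>s. s \<in> S \<Longrightarrow> V s < \<infinity>"
    and drift: "\<And>s. s \<in> S \<Longrightarrow> s \<noteq> z \<Longrightarrow> f s + 1 + (\<integral>\<^sup>+ t. V t \<partial>measure_pmf (K s)) \<le> V s"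
    and drift_z: "f z + (\<integral>\<^sup>+ t. V t \<partial>measure_pmf (K z)) \<le> V z + b"
  shows "liminf (\<lambda>T. total T z / of_nat T) < \<infinity>"
    and "\<And>s. s \<in> S \<Longrightarrow> liminf (\<lambda>T. total T s / of_nat T) = liminf (\<lambda>T. total T z / of_nat T)"
proof -
  have drift_cost: "f s + (\<integral>\<^sup>+ t. V t \<partial>measure_pmf (K s)) \<le> V s"
    and drift_time: "1 + (\<integral>\<^sup>+ t. V t \<partial>measure_pmf (K s)) \<le> V s" if "s \<in> S" "s \<noteq> z" for s
  proof -
    define I where "I = (\<integral>\<^sup>+ t. V t \<partial>measure_pmf (K s))"
    have "f s + I \<le> f s + I + 1" "1 + I \<le> f s + (1 + I)" by (rule le_iff_add[THEN iffD2], force simp: add.commute)+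
    moreover have "f s + 1 + I \<le> V s" using drift[OF that] by (simp add: I_def)
    ultimately show "f s + (\<integral>\<^sup>+ t. V t \<partial>measure_pmf (K s)) \<le> V s" "1 + (\<integral>\<^sup>+ t. V t \<partial>measure_pmf (K s)) \<le> V s"
      unfolding I_def[symmetric] by (metis add.assoc add.commute order_trans)+
  qed
  have drift_b: "f s + (\<integral>\<^sup>+ t. V t \<partial>measure_pmf (K s)) \<le> V s + b" if "s \<in> S" for s
    using drift_cost[OF that] drift_z by (cases "s = z") (auto intro: order_trans)
  note total_le = total_le_drift[of V b, OF drift_b]
  define v where "v s = enn2real (V s)" for s
  define \<beta> where "\<beta> = enn2real b"
  define J where "J T s = enn2real (total T s)" for T s
  have V_eq: "V s = ennreal (v s)" if "s \<in> S" for s using V[OF that] by (simp add: v_def)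
  have b_eq: "b = ennreal \<beta>" using b by (simp add: \<beta>_def)
  have nonneg: "v s \<ge> 0" "\<beta> \<ge> 0" "J T s \<ge> 0" for T s by (auto simp: v_def \<beta>_def J_def)
  have fin: "total T s < \<infinity>" if "s \<in> S" for T s
  proof -
    have "V s + b * of_nat T < \<infinity>" using V[OF that] b of_nat_less_top[of T] by (simp add: ennreal_mult_less_top)
    thus ?thesis using total_le[OF _ that, of T] by (meson order_le_less_trans)
  qed
  have J_eq: "total T s = ennreal (J T s)" if "s \<in> S" for T s using fin[OF that] by (simp add: J_def)
  have J_le: "J T s \<le> v s + \<beta> * real T" if "s \<in> S" for T s
    using total_le[OF _ that, of T] that nonneg
    by (simp add: J_eq V_eq b_eq flip: ennreal_of_nat_eq_real_of_nat ennreal_mult ennreal_plus)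
       (simp add: ennreal_of_nat_eq_real_of_nat flip: ennreal_mult ennreal_plus)
  have avg_eq: "total T s / of_nat T = ennreal (J T s / real T)" if "s \<in> S" "T \<ge> 1" for s T
    using that nonneg by (simp add: J_eq ennreal_of_nat_eq_real_of_nat divide_ennreal)
  have liminf_eq: "liminf (\<lambda>T. total T s / of_nat T) = liminf (\<lambda>T. ennreal (J T s / real T))"
    if "s \<in> S" for s
    by (rule Liminf_eq) (use avg_eq[OF that] in \<open>auto simp: eventually_sequentially\<close>)
  have J_avg_le: "J T s / real T \<le> v s + \<beta>" if "s \<in> S" "T \<ge> 1" for s T
  proof -
    have "J T s \<le> v s * 1 + \<beta> * real T" using J_le[OF that(1)] by simp
    also have "\<dots> \<le> v s * real T + \<beta> * real T"
      using that(2) nonneg by (intro add_right_mono mult_left_mono) auto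
    finally show ?thesis using that(2) by (simp add: field_simps)
  qed
  have "liminf (\<lambda>T. total T z / of_nat T) \<le> liminf (\<lambda>T. ennreal (v z + \<beta>))"
    unfolding liminf_eq[OF z]
    by (rule Liminf_mono) (use J_avg_le[OF z] in \<open>auto simp: eventually_sequentially intro!: ennreal_leI exI[of _ 1]\<close>)
  also have "\<dots> < \<infinity>" by (simp add: Liminf_const)
  finally show "liminf (\<lambda>T. total T z / of_nat T) < \<infinity>" .
  fix s assume s: "s \<in> S"
  show "liminf (\<lambda>T. total T s / of_nat T) = liminf (\<lambda>T. total T z / of_nat T)"
    unfolding liminf_eq[OF s] liminf_eq[OF z]
  proof (rule antisym)
    have shift: "J (T + k) x / real T
        \<le> J (T + k) x / real (T + k) + (v x + \<beta>) * (real k / real T)"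
      if "T \<ge> 1" "x \<in> S" for T k x
    proof -
      have "J (T + k) x / real T = J (T + k) x / real (T + k) * (1 + real k / real T)"
        using that(1) by (simp add: divide_simps)
      also have "\<dots> = J (T + k) x / real (T + k) + J (T + k) x / real (T + k) * (real k / real T)"
        by (simp add: distrib_left)
      also have "J (T + k) x / real (T + k) * (real k / real T) \<le> (v x + \<beta>) * (real k / real T)"
        using that by (intro mult_right_mono J_avg_le) auto
      finally show ?thesis by simp
    qed
    show "liminf (\<lambda>T. ennreal (J T s / real T)) \<le> liminf (\<lambda>T. ennreal (J T z / real T))"
    proof (rule liminf_le_liminf_of_shifted_bound[where c = 0 and d = "v s + v z + \<beta>"])
      fix T k :: nat assume T: "T \<ge> 1" and k: "k \<ge> 1"
      have "ennreal (J T s) \<le> ennreal (v s + J T z)"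
        using total_le_total_from[where z = z and T = T, OF drift_cost s] nonneg by (simp add: J_eq V_eq s z ennreal_plus)
      hence "J T s \<le> v s + J T z" using nonneg by (simp add: add_nonneg_nonneg del: ennreal_plus)
      also have "J T z \<le> J (T + k) z"
      proof -
        have "total T z \<le> total (T + k) z"
          using lift_Suc_mono_le[of "\<lambda>T. total T z" T "T + k"] total_mono by auto
        thus ?thesis using nonneg by (simp add: J_eq z)
      qed
      finally have "J T s / real T \<le> (v s + J (T + k) z) / real T"
        using T by (intro divide_right_mono) auto
      also have "\<dots> = v s * (1 / real T) + J (T + k) z / real T" by (simp add: add_divide_distrib)
      also have "v s * (1 / real T) \<le> v s * (real k / real T)"
        using k nonneg by (intro mult_left_mono divide_right_mono) auto
      also note shift[OF T z, of k]
      finally show "J T s / real T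
          \<le> J (T + k) z / real (T + k) + 0 / real k + (v s + v z + \<beta>) * real k / real T"
        by (simp add: algebra_simps add_divide_distrib)
    qed
    show "liminf (\<lambda>T. ennreal (J T z / real T)) \<le> liminf (\<lambda>T. ennreal (J T s / real T))"
    proof (rule liminf_le_liminf_of_shifted_bound[where c = "v s * (v z + \<beta>)" and d = "v s + \<beta>"])
      fix T k :: nat assume T: "T \<ge> 1" and k: "k \<ge> 1"
      define r where "r = enn2real (not_hit z k s)"
      have r_eq: "not_hit z k s = ennreal r" and r_nonneg: "r \<ge> 0"
        using not_hit_le_1[of z k s] by (auto simp: r_def order_le_less_trans)
      have "ennreal (real k * r) \<le> ennreal (v s)"
        using not_hit_le_drift[where z = z and k = k, OF drift_time s] r_nonneg
        by (simp add: r_eq V_eq s ennreal_mult ennreal_of_nat_eq_real_of_nat)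
      hence r_le: "r \<le> v s / real k" using nonneg k by (simp add: field_simps)
      have "ennreal (J T z) \<le> ennreal (J (T + k) s + r * J T z)"
        using total_from_le_total[OF s, where T = T and z = z and k = k] nonneg r_nonneg
        by (simp add: J_eq r_eq s z ennreal_plus ennreal_mult)
      hence "J T z \<le> J (T + k) s + r * J T z"
        using nonneg r_nonneg by (simp add: add_nonneg_nonneg del: ennreal_plus)
      hence "J T z / real T \<le> (J (T + k) s + r * J T z) / real T"
        by (intro divide_right_mono) auto
      also have "\<dots> = J (T + k) s / real T + r * (J T z / real T)"
        by (simp add: add_divide_distrib)
      also have "r * (J T z / real T) \<le> (v s / real k) * (v z + \<beta>)"
        using r_le r_nonneg nonneg J_avg_le[OF z T] by (intro mult_mono) auto
      also note shift[OF T s, of k]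
      finally show "J T z / real T
          \<le> J (T + k) s / real (T + k) + v s * (v z + \<beta>) / real k + (v s + \<beta>) * real k / real T"
        by simp
    qed
  qed
qed

end

section \<open>Expectations after one transition\<close>

context uniformized_server_network
begin

lemma finite_demand_points: "finite (demand_points N)"
proof -
  interpret G: pair_graph "network N" by (rule graph)
  show ?thesis using demand_points_subset G.pair_finite_verts by (rule finite_subset)
qed

text \<open>
  The possible outcomes of one step from \<open>s\<close> under action \<open>a\<close>, including the event that nothing
  happens.
\<close>

definition successors :: "'v state \<Rightarrow> 'v \<Rightarrow> 'v state set" where
  "successors s a = {s} \<union> (\<lambda>i. add_job i s) ` demand_points N
     \<union> (if a = fst s \<and> a \<in> demand_points N \<and> snd s a \<ge> 1 then {remove_job a s} else {})
     \<union> (if a \<in> adjacent_nodes N s then {(a, snd s)} else {})"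

lemma finite_successors: "finite (successors s a)"
  using finite_demand_points by (simp add: successors_def)

lemma set_transition_subset:
  assumes "s \<in> states N" and "a \<in> actions N s"
  shows "set_pmf (transition N s a) \<subseteq> successors s a"
proof
  fix t assume "t \<in> set_pmf (transition N s a)"
  hence nz: "transition_prob N s a t \<noteq> 0"
    by (simp add: set_pmf_iff pmf_transition[OF assms])
  show "t \<in> successors s a"
  proof (rule ccontr)
    assume t: "t \<notin> successors s a"
    hence "{i. i \<in> demand_points N \<and> t = add_job i s} = {}"
      by (auto simp: successors_def)
    hence "move_prob N s a t = 0"
      using t by (auto simp: move_prob_def successors_def simp del: Collect_empty_eq)
    moreover have "t \<noteq> s" using t by (auto simp: successors_def)
    ultimately show False using nz by (simp add: transition_prob_def)
  qed
qed

lemma successors_subset_states: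
  assumes "s \<in> states N" and "a \<in> actions N s"
  shows "successors s a \<subseteq> states N"
proof -
  interpret G: pair_graph "network N" by (rule graph)
  have "w \<in> pverts (network N)" if "(fst s, w) \<in> parcs (network N)" for w
    using G.arc_snd_in_verts[OF that] by simp
  thus ?thesis using assms
    by (auto simp: successors_def states_def add_job_def remove_job_def adjacent_nodes_def
        PiE_iff extensional_def)
qed

lemma transition_closed:
  "s \<in> states N \<Longrightarrow> a \<in> actions N s \<Longrightarrow> set_pmf (transition N s a) \<subseteq> states N"
  using set_transition_subset successors_subset_states by blast

lemma finite_set_transition:
  assumes "s \<in> states N" and "a \<in> actions N s"
  shows "finite (set_pmf (transition N s a))"
  using set_transition_subset[OF assms] finite_successors by (rule finite_subset)

lemma expectation_mono:
  fixes F G :: "'v state \<Rightarrow> real"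
  assumes "s \<in> states N" and "a \<in> actions N s" and "\<And>t. F t \<le> G t"
  shows "measure_pmf.expectation (transition N s a) F \<le> measure_pmf.expectation (transition N s a) G"
  using assms(3)
  by (intro integral_mono integrable_measure_pmf_finite finite_set_transition[OF assms(1,2)])

text \<open>
  The mean change of \<open>F\<close> in one step is the sum over the possible jumps of rate times change; the
  probability of staying put contributes nothing.
\<close>

lemma expectation_transition:
  fixes F :: "'v state \<Rightarrow> real"
  assumes s: "s \<in> states N" and a: "a \<in> actions N s"
  shows "measure_pmf.expectation (transition N s a) F = F s
    + (\<Sum>i\<in>demand_points N. arrival_rate N i * (F (add_job i s) - F s))
    + (if a = fst s \<and> a \<in> demand_points N \<and> snd s a \<ge> 1
       then service_rate N a * (F (remove_job a s) - F s) else 0)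
    + (if a \<in> adjacent_nodes N s then switch_rate N * (F (a, snd s) - F s) else 0)"
proof -
  define D where "D = demand_points N"
  define A where "A = successors s a"
  define P where "P \<longleftrightarrow> a = fst s \<and> a \<in> D \<and> snd s a \<ge> 1"
  define Q where "Q \<longleftrightarrow> a \<in> adjacent_nodes N s"
  define G where "G t = F t - F s" for t
  have finA: "finite A" by (simp add: A_def finite_successors)
  have A_mem: "s \<in> A" "\<And>i. i \<in> D \<Longrightarrow> add_job i s \<in> A" "P \<Longrightarrow> remove_job a s \<in> A" "Q \<Longrightarrow> (a, snd s) \<in> A"
    by (auto simp: A_def successors_def D_def P_def Q_def)
  let ?p = "pmf (transition N s a)"
  have G_pmf: "G t * ?p t = (\<Sum>i\<in>D. if t = add_job i s then G t * arrival_rate N i else 0)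
      + (if t = remove_job a s then if P then G t * service_rate N a else 0 else 0)
      + (if t = (a, snd s) then if Q then G t * switch_rate N else 0 else 0)" for t
  proof (cases "t = s")
    case False
    have "move_prob N s a t = (\<Sum>i\<in>D. if t = add_job i s then arrival_rate N i else 0)
      + (if t = remove_job a s then if P then service_rate N a else 0 else 0)
      + (if t = (a, snd s) then if Q then switch_rate N else 0 else 0)"
      using finite_demand_points
      by (auto simp: move_prob_def D_def P_def Q_def sum.inter_filter)
    thus ?thesis using False
      by (auto simp: pmf_transition[OF s a] transition_prob_def distrib_left sum_distrib_left
          intro!: sum.cong)
  qed (auto simp: G_def intro!: sum.neutral)
  have "measure_pmf.expectation (transition N s a) F = (\<Sum>t\<in>A. F t * ?p t)"
    by (rule integral_measure_pmf_real) (use finA set_transition_subset[OF s a] in \<open>auto simp: A_def\<close>)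
  also have "\<dots> = (\<Sum>t\<in>A. F s * ?p t + G t * ?p t)"
    by (simp add: G_def algebra_simps)
  also have "\<dots> = F s * (\<Sum>t\<in>A. ?p t) + (\<Sum>t\<in>A. G t * ?p t)"
    by (simp add: sum.distrib sum_distrib_left)
  also have "(\<Sum>t\<in>A. ?p t) = 1"
    using finA set_transition_subset[OF s a] by (intro sum_pmf_eq_1) (auto simp: A_def)
  also have "(\<Sum>t\<in>A. G t * ?p t)
      = (\<Sum>i\<in>D. \<Sum>t\<in>A. if t = add_job i s then G t * arrival_rate N i else 0)
      + (\<Sum>t\<in>A. if t = remove_job a s then if P then G t * service_rate N a else 0 else 0)
      + (\<Sum>t\<in>A. if t = (a, snd s) then if Q then G t * switch_rate N else 0 else 0)"
    unfolding G_pmf sum.distrib by (simp only: sum.swap[of _ D A])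
  also have "(\<Sum>i\<in>D. \<Sum>t\<in>A. if t = add_job i s then G t * arrival_rate N i else 0)
      = (\<Sum>i\<in>D. arrival_rate N i * G (add_job i s))"
    using finA A_mem by (intro sum.cong) (auto simp: sum.delta)
  also have "(\<Sum>t\<in>A. if t = remove_job a s then if P then G t * service_rate N a else 0 else 0)
      = (if P then service_rate N a * G (remove_job a s) else 0)"
    using finA A_mem by (simp add: sum.delta)
  also have "(\<Sum>t\<in>A. if t = (a, snd s) then if Q then G t * switch_rate N else 0 else 0)
      = (if Q then switch_rate N * G (a, snd s) else 0)"
    using finA A_mem by (simp add: sum.delta)
  finally show ?thesis unfolding G_def D_def P_def Q_def by (simp only: add.assoc)
qed

end

section \<open>Distances and rates\<close>

text \<open>
  The least number of \<open>R\<close>-steps from \<open>x\<close> to \<open>y\<close>. The value is meaningful only if \<open>y\<close> is reachable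
  from \<open>x\<close>.
\<close>

definition hops :: "('a \<times> 'a) set \<Rightarrow> 'a \<Rightarrow> 'a \<Rightarrow> nat" where
  "hops R x y = (LEAST n. (x, y) \<in> R ^^ n)"

lemma hops_self [simp]: "hops R x x = 0"
  by (simp add: hops_def)

lemma hops_step:
  assumes "(x, y) \<in> R\<^sup>*" and "x \<noteq> y"
  obtains x' where "(x, x') \<in> R" and "hops R x y = Suc (hops R x' y)"
proof -
  have ex: "\<exists>n. (x, y) \<in> R ^^ n" using assms(1) by (simp add: rtrancl_power)
  have in_pow: "(x, y) \<in> R ^^ hops R x y"
    unfolding hops_def using ex by (rule LeastI_ex)
  with assms(2) obtain n where n: "hops R x y = Suc n"
    by (cases "hops R x y") auto
  with in_pow obtain x' where x': "(x, x') \<in> R" "(x', y) \<in> R ^^ n"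
    by (metis relpow_Suc_D2)
  have "hops R x' y \<le> n" unfolding hops_def using x'(2) by (rule Least_le)
  moreover have "(x', y) \<in> R ^^ hops R x' y"
    unfolding hops_def using x'(2) by (rule LeastI)
  hence "(x, y) \<in> R ^^ Suc (hops R x' y)" using x'(1) by (rule relpow_Suc_I2[rotated])
  hence "hops R x y \<le> Suc (hops R x' y)" unfolding hops_def[of R x y] by (rule Least_le)
  ultimately show ?thesis using that x'(1) n by simp
qed

context uniformized_server_network
begin

lemma total_rate_eq_1:
  "(\<Sum>i\<in>demand_points N. arrival_rate N i)
     + Max (insert (switch_rate N) (service_rate N ` demand_points N)) = 1"
  using time_scaled unfolding uniformization_step_def by (metis inverse_1 inverse_inverse_eq)

lemma switch_rate_le_1: "switch_rate N \<le> 1"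
  and service_rate_le_1: "i \<in> demand_points N \<Longrightarrow> service_rate N i \<le> 1"
proof -
  let ?R = "insert (switch_rate N) (service_rate N ` demand_points N)"
  have "(\<Sum>i\<in>demand_points N. arrival_rate N i) \<ge> 0"
    using arrival_rate_pos by (intro sum_nonneg) (auto intro: less_imp_le)
  hence le: "Max ?R \<le> 1" using total_rate_eq_1 by linarith
  have ge: "r \<le> Max ?R" if "r \<in> ?R" for r
    using that finite_demand_points by (intro Max_ge) auto
  show "switch_rate N \<le> 1" using ge[of "switch_rate N"] le by simp
  show "service_rate N i \<le> 1" if "i \<in> demand_points N"
    using ge[of "service_rate N i"] that le by simp
qed

lemma nodes_reachable:
  assumes "u \<in> pverts (network N)" and "v \<in> pverts (network N)"
  shows "(u, v) \<in> (parcs (network N))\<^sup>*"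
proof -
  interpret G: pair_graph "network N" by (rule graph)
  have "strongly_connected (with_proj (network N))"
    using G.pair_sym_arcs connected by (rule G.symmetric_connected_imp_strongly_connected)
  hence "u \<rightarrow>\<^sup>*\<^bsub>with_proj (network N)\<^esub> v"
    using assms by (auto simp: strongly_connected_def)
  thus ?thesis unfolding reachable_def by (auto dest: rtrancl_on_rtranclI)
qed

lemma nodes_nonempty: "pverts (network N) \<noteq> {}"
  using connected by (auto simp: connected_def strongly_connected_def)

lemma arc_adjacent:
  assumes "(fst s, w) \<in> parcs (network N)"
  shows "w \<in> adjacent_nodes N s" and "w \<in> actions N s" and "w \<noteq> fst s" and "w \<in> pverts (network N)"
proof -
  interpret G: pair_graph "network N" by (rule graph)
  show "w \<noteq> fst s" using G.pair_no_loops[OF assms] by auto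
  thus "w \<in> adjacent_nodes N s" "w \<in> actions N s"
    using assms by (auto simp: adjacent_nodes_def actions_def)
  show "w \<in> pverts (network N)" using G.arc_snd_in_verts[OF assms] by simp
qed

section \<open>Drift for large workloads\<close>

text \<open>The expected time that the server needs to process all jobs present.\<close>

definition workload :: "'v state \<Rightarrow> real" where
  "workload s = (\<Sum>i\<in>demand_points N. real (snd s i) / service_rate N i)"

lemma workload_nonneg: "workload s \<ge> 0"
  unfolding workload_def using service_rate_pos
  by (intro sum_nonneg divide_nonneg_pos) auto

lemma workload_add_job:
  assumes "i \<in> demand_points N"
  shows "workload (add_job i s) = workload s + 1 / service_rate N i"
proof -
  have "workload (add_job i s)
      = (\<Sum>k\<in>demand_points N. real (snd s k) / service_rate N k + (if k = i then 1 / service_rate N i else 0))"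
    unfolding workload_def add_job_def by (intro sum.cong) (auto simp: add_divide_distrib)
  thus ?thesis using assms finite_demand_points by (simp add: sum.distrib workload_def)
qed

lemma workload_remove_job:
  assumes "i \<in> demand_points N" and "snd s i \<ge> 1"
  shows "workload (remove_job i s) = workload s - 1 / service_rate N i"
proof -
  have "add_job i (remove_job i s) = s"
    using assms(2) by (simp add: add_job_def remove_job_def)
  thus ?thesis using workload_add_job[OF assms(1), of "remove_job i s"] by simp
qed

lemma workload_switch: "workload (w, snd s) = workload s"
  by (simp add: workload_def)

lemma step_cost_le_workload:
  "step_cost N s \<le> (\<Sum>i\<in>demand_points N. holding_cost N i * service_rate N i) * workload s"
proof -
  let ?K = "\<Sum>i\<in>demand_points N. holding_cost N i * service_rate N i"
  have nonneg: "holding_cost N i * service_rate N i \<ge> 0" if "i \<in> demand_points N" for i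
    using holding_cost_pos[OF that] service_rate_pos[OF that] by simp
  have "holding_cost N i * real (snd s i) \<le> ?K * (real (snd s i) / service_rate N i)"
    if i: "i \<in> demand_points N" for i
  proof -
    have "holding_cost N i * real (snd s i)
        = (holding_cost N i * service_rate N i) * (real (snd s i) / service_rate N i)"
      using service_rate_pos[OF i] by simp
    also have "\<dots> \<le> ?K * (real (snd s i) / service_rate N i)"
      using i service_rate_pos[OF i] finite_demand_points nonneg
      by (intro mult_right_mono member_le_sum) (auto intro!: less_imp_le)
    finally show ?thesis .
  qed
  thus ?thesis unfolding step_cost_def workload_def sum_distrib_left by (intro sum_mono)
qed

text \<open>The mean time of a shortest trip from \<open>u\<close> to \<open>v\<close>, at \<open>1 / \<tau>\<close> per edge.\<close>

definition travel_time :: "'v \<Rightarrow> 'v \<Rightarrow> real" where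
  "travel_time u v = real (hops (parcs (network N)) u v) / switch_rate N"

definition max_travel_time :: real where
  "max_travel_time = Max (case_prod travel_time ` (pverts (network N) \<times> pverts (network N)))"

lemma travel_time_nonneg: "travel_time u v \<ge> 0"
  using switch_rate_pos by (simp add: travel_time_def)

lemma travel_time_le:
  assumes "u \<in> pverts (network N)" and "v \<in> pverts (network N)"
  shows "travel_time u v \<le> max_travel_time"
proof -
  interpret G: pair_graph "network N" by (rule graph)
  show ?thesis unfolding max_travel_time_def
    using assms G.pair_finite_verts by (intro Max_ge) auto
qed

lemma max_travel_time_nonneg: "max_travel_time \<ge> 0"
  using nodes_nonempty travel_time_le travel_time_nonneg by (meson ex_in_conv order_trans)

text \<open>
  Half of the spare capacity \<open>1 - \<rho>\<close>: while serving, the server puts aside up to this share of its time as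
  an allowance for the next trip.
\<close>

definition slack :: real where
  "slack = (1 - traffic_intensity N) / 2"

text \<open>
  The switching time that is owed when \<open>j\<close> is the current target: the trip to \<open>j\<close>, plus a debt for the
  trip after that, which builds up gradually as queue \<open>j\<close> runs low and which exceeds every travel time
  once the queue is empty.
\<close>

definition delay_to :: "'v state \<Rightarrow> 'v \<Rightarrow> real" where
  "delay_to s j = travel_time (fst s) j + max 0 (1 + max_travel_time - slack * real (snd s j))"

text \<open>
  Only used if there are demand points. The server aims for a demand point that attains this
  minimum. If some queue is long, its demand point has a debt of zero, so an empty queue never attains
  the minimum at the server's own node.
\<close>

definition delay :: "'v state \<Rightarrow> real" where
  "delay s = Min (delay_to s ` demand_points N)"

text \<open>
  The square of the workload with a correction: the mixed term spreads the growth of the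
  workload during trips over the preceding service periods.
\<close>

definition energy :: "'v state \<Rightarrow> real" where
  "energy s = (workload s)\<^sup>2 + 2 * workload s * delay s"

lemma delay_to_nonneg: "delay_to s j \<ge> 0"
  using travel_time_nonneg by (simp add: delay_to_def)

lemma delay_le: "j \<in> demand_points N \<Longrightarrow> delay s \<le> delay_to s j"
  unfolding delay_def using finite_demand_points by (intro Min_le) auto

lemma delay_attained:
  assumes "demand_points N \<noteq> {}"
  obtains j where "j \<in> demand_points N" and "delay s = delay_to s j"
proof -
  have "delay s \<in> delay_to s ` demand_points N"
    unfolding delay_def using finite_demand_points assms by (intro Min_in) auto
  thus ?thesis using that by auto
qed

lemma energy_nonneg: "energy s \<ge> 0"
proof (cases "demand_points N = {}")
  case True
  thus ?thesis by (simp add: energy_def workload_def)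
next
  case False
  then obtain j where "delay s = delay_to s j" using delay_attained by metis
  thus ?thesis using workload_nonneg delay_to_nonneg by (simp add: energy_def)
qed

lemma traffic_intensity_nonneg: "traffic_intensity N \<ge> 0"
  unfolding traffic_intensity_def using arrival_rate_pos service_rate_pos
  by (intro sum_nonneg) (auto intro!: divide_nonneg_pos less_imp_le)

lemma exists_long_queue:
  assumes "traffic_intensity N < 1"
    and large: "workload s > (1 + max_travel_time) / slack * (\<Sum>i\<in>demand_points N. 1 / service_rate N i)"
  obtains i where "i \<in> demand_points N" and "slack * real (snd s i) \<ge> 1 + max_travel_time"
proof (rule ccontr)
  note found = that
  assume no: "\<not> thesis"
  have slack: "slack > 0" using assms(1) by (simp add: slack_def)
  have "real (snd s i) / service_rate N i \<le> (1 + max_travel_time) / slack * (1 / service_rate N i)"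
    if i: "i \<in> demand_points N" for i
  proof -
    have "slack * real (snd s i) < 1 + max_travel_time" using no found[OF i] by argo
    hence "real (snd s i) \<le> (1 + max_travel_time) / slack"
      using slack by (simp add: field_simps)
    hence "real (snd s i) / service_rate N i \<le> (1 + max_travel_time) / slack / service_rate N i"
      using service_rate_pos[OF i] by (intro divide_right_mono) auto
    thus ?thesis by simp
  qed
  hence "workload s \<le> (1 + max_travel_time) / slack * (\<Sum>i\<in>demand_points N. 1 / service_rate N i)"
    unfolding workload_def sum_distrib_left by (intro sum_mono)
  thus False using large by simp
qed

text \<open>
  In states with a large workload \<open>W\<close>, moving toward the target, or serving there, lowers the mean
  energy by \<open>(1 - \<rho>) W\<close> up to a constant. Arrivals contribute \<open>2 \<rho> W\<close> up to a constant. Traveling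
  contributes \<open>- 2 W\<close> because it shortens the delay; service contributes \<open>- 2 W\<close> because it lowers the
  workload, and at most \<open>(1 - \<rho>) W\<close> because it raises the debt.
\<close>

lemma energy_drift:
  assumes stable: "traffic_intensity N < 1"
  obtains W0 B where "\<forall>s\<in>states N. workload s > W0 \<longrightarrow>
    (\<exists>a\<in>actions N s. measure_pmf.expectation (transition N s a) energy
      \<le> energy s - (1 - traffic_intensity N) * workload s + B)"
proof -
  define D where "D = demand_points N"
  define \<rho> where "\<rho> = traffic_intensity N"
  define \<mu> where "\<mu> = service_rate N"
  define d where "d = max_travel_time"
  define W0 where "W0 = (1 + d) / slack * (\<Sum>i\<in>D. 1 / \<mu> i)"
  define Q where "Q = (\<Sum>i\<in>D. arrival_rate N i * (1 / \<mu> i)\<^sup>2)"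
  define B where "B = Q + 2 * \<rho> * (1 + 2 * d) + (\<Sum>i\<in>D. 1 / \<mu> i)"
  have \<mu>_pos: "\<mu> i > 0" and \<mu>_le: "\<mu> i \<le> 1" if "i \<in> D" for i
    using that service_rate_pos service_rate_le_1 by (auto simp: D_def \<mu>_def)
  have slack: "slack > 0" "2 * slack = 1 - \<rho>" using stable by (auto simp: slack_def \<rho>_def)
  have \<rho>: "\<rho> \<ge> 0" "\<rho> < 1" using traffic_intensity_nonneg stable by (auto simp: \<rho>_def)
  have d: "d \<ge> 0" using max_travel_time_nonneg by (simp add: d_def)
  have inv_le: "1 / \<mu> j \<le> (\<Sum>i\<in>D. 1 / \<mu> i)" if "j \<in> D" for j
    using that finite_demand_points \<mu>_pos
    by (intro member_le_sum) (auto simp: D_def intro: less_imp_le)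
  have inv_sum: "(\<Sum>i\<in>D. 1 / \<mu> i) \<ge> 0"
    using \<mu>_pos by (intro sum_nonneg) (auto intro: less_imp_le)
  show thesis
  proof (rule that[of W0 B], intro ballI impI)
    fix s assume s: "s \<in> states N" and large: "workload s > W0"
    define W where "W = workload s"
    have W: "W \<ge> 0" using workload_nonneg by (simp add: W_def)
    obtain i where i: "i \<in> D" "slack * real (snd s i) \<ge> 1 + d"
      using exists_long_queue[OF stable, of s] large
      unfolding W0_def d_def D_def \<mu>_def by blast
    then obtain j where j: "j \<in> D" "delay s = delay_to s j"
      using delay_attained[of s] by (auto simp: D_def)
    define U where "U t = (workload t)\<^sup>2 + 2 * workload t * delay_to t j" for t
    define H where "H = delay_to s j"
    have nodes: "fst s \<in> pverts (network N)" "i \<in> pverts (network N)" "j \<in> pverts (network N)"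
      using s i(1) j(1) demand_points_subset by (auto simp: states_def D_def)
    \<comment> \<open>Freezing the target \<open>j\<close> gives a majorant of the energy that agrees with it in \<open>s\<close>, so it
       suffices to bound the drift of the majorant.\<close>
    have energy_le: "energy t \<le> U t" for t
      using delay_le[of j t] j(1) workload_nonneg[of t] by (auto simp: energy_def U_def D_def intro!: mult_left_mono)
    have U_s: "U s = energy s" "U s = W\<^sup>2 + 2 * W * H" by (simp_all add: U_def energy_def j(2) W_def H_def)
    have H: "H \<ge> 0" by (simp add: H_def delay_to_nonneg)
    have H_le: "H \<le> 1 + 2 * d"
    proof -
      have "slack * real (snd s j) \<ge> 0" using slack by simp
      thus ?thesis using travel_time_le[OF nodes(1,3)] d by (auto simp: H_def delay_to_def d_def)
    qed
    have arrivals: "(\<Sum>k\<in>D. arrival_rate N k * (U (add_job k s) - U s))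
        \<le> 2 * W * \<rho> + Q + 2 * \<rho> * (1 + 2 * d)"
    proof -
      have "arrival_rate N k * (U (add_job k s) - U s)
          \<le> 2 * (W + H) * (arrival_rate N k / \<mu> k) + arrival_rate N k * (1 / \<mu> k)\<^sup>2"
        if k: "k \<in> D" for k
      proof -
        define w where "w = 1 / \<mu> k"
        have w: "w \<ge> 0" using \<mu>_pos[OF k] by (simp add: w_def)
        have "delay_to (add_job k s) j \<le> H"
        proof -
          have "slack * real (snd s j) \<le> slack * real (snd (add_job k s) j)"
            using slack by (intro mult_left_mono) (auto simp: add_job_def)
          thus ?thesis by (auto simp: H_def delay_to_def add_job_def)
        qed
        hence "2 * (W + w) * delay_to (add_job k s) j \<le> 2 * (W + w) * H"
          using W w by (intro mult_left_mono) auto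
        hence "U (add_job k s) - U s \<le> 2 * (W + H) * w + w\<^sup>2"
          using k workload_add_job[of k s]
          by (simp add: U_def W_def[symmetric] H_def[symmetric] w_def[symmetric] \<mu>_def[symmetric]
              D_def[symmetric] power2_eq_square algebra_simps)
        hence "arrival_rate N k * (U (add_job k s) - U s) \<le> arrival_rate N k * (2 * (W + H) * w + w\<^sup>2)"
          using arrival_rate_pos k by (intro mult_left_mono) (auto simp: D_def intro: less_imp_le)
        thus ?thesis by (simp add: w_def algebra_simps)
      qed
      hence "(\<Sum>k\<in>D. arrival_rate N k * (U (add_job k s) - U s))
          \<le> (\<Sum>k\<in>D. 2 * (W + H) * (arrival_rate N k / \<mu> k) + arrival_rate N k * (1 / \<mu> k)\<^sup>2)"
        by (rule sum_mono)
      also have "\<dots> = 2 * (W + H) * \<rho> + Q"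
        by (simp add: sum.distrib Q_def \<rho>_def traffic_intensity_def D_def \<mu>_def sum_distrib_left)
      also have "\<dots> \<le> 2 * W * \<rho> + Q + 2 * \<rho> * (1 + 2 * d)"
        using mult_left_mono[OF H_le \<rho>(1)] by (simp add: algebra_simps)
      finally show ?thesis .
    qed
    have reduce: "\<exists>a\<in>actions N s. measure_pmf.expectation (transition N s a) energy
        \<le> energy s - (1 - traffic_intensity N) * workload s + B"
      if a: "a \<in> actions N s"
        and control: "(if a = fst s \<and> a \<in> D \<and> snd s a \<ge> 1 then \<mu> a * (U (remove_job a s) - U s) else 0)
          + (if a \<in> adjacent_nodes N s then switch_rate N * (U (a, snd s) - U s) else 0)
          \<le> - 2 * W + (1 - \<rho>) * W + (\<Sum>i\<in>D. 1 / \<mu> i)" for a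
    proof
      have "measure_pmf.expectation (transition N s a) energy
          \<le> measure_pmf.expectation (transition N s a) U"
        using s a energy_le by (rule expectation_mono)
      also have "\<dots> \<le> U s + (2 * W * \<rho> + Q + 2 * \<rho> * (1 + 2 * d))
          + (- 2 * W + (1 - \<rho>) * W + (\<Sum>i\<in>D. 1 / \<mu> i))"
        using expectation_transition[OF s a, of U] arrivals control
        unfolding D_def \<mu>_def by linarith
      also have "\<dots> = energy s - (1 - traffic_intensity N) * workload s + B"
        unfolding U_s(1) B_def \<rho>_def[symmetric] W_def[symmetric] by (simp add: algebra_simps)
      finally show "measure_pmf.expectation (transition N s a) energy
          \<le> energy s - (1 - traffic_intensity N) * workload s + B" .
    qed (rule a)
    show "\<exists>a\<in>actions N s. measure_pmf.expectation (transition N s a) energy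
        \<le> energy s - (1 - traffic_intensity N) * workload s + B"
    proof (cases "fst s = j")
      case False
      obtain w where w: "(fst s, w) \<in> parcs (network N)"
        "hops (parcs (network N)) (fst s) j = Suc (hops (parcs (network N)) w j)"
        using hops_step[OF nodes_reachable[OF nodes(1,3)] False] by blast
      have nearer: "delay_to (w, snd s) j = H - 1 / switch_rate N"
        using switch_rate_pos by (simp add: H_def delay_to_def travel_time_def w(2) add_divide_distrib)
      have "U (w, snd s) - U s = - 2 * W / switch_rate N"
        unfolding U_s(2) by (simp add: U_def workload_switch W_def[symmetric] nearer right_diff_distrib)
      hence "switch_rate N * (U (w, snd s) - U s) = - 2 * W" using switch_rate_pos by simp
      moreover have "(1 - \<rho>) * W \<ge> 0" using W \<rho> by simp
      ultimately show ?thesis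
        using inv_sum arc_adjacent[OF w(1)] by (intro reduce[of w]) auto
    next
      case True
      have "delay_to s i \<le> d"
        using travel_time_le[OF nodes(1,2)] i(2) by (simp add: delay_to_def d_def)
      hence "H \<le> d" using delay_le[of i s] i(1) j(2) by (simp add: H_def D_def)
      \<comment> \<open>With an empty queue at \<open>j\<close> the debt would be \<open>1 + d\<close>.\<close>
      hence busy: "snd s j \<ge> 1"
        using travel_time_nonneg[of j j] by (cases "snd s j") (auto simp: H_def delay_to_def d_def True)
      define w where "w = 1 / \<mu> j"
      have w: "w \<ge> 0" "\<mu> j * w = 1" using \<mu>_pos[OF j(1)] by (auto simp: w_def)
      have W': "workload (remove_job j s) = W - w"
        using workload_remove_job[of j s] j(1) busy by (simp add: D_def W_def w_def \<mu>_def)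
      have "delay_to (remove_job j s) j \<le> H + slack"
      proof -
        have "slack * real (snd (remove_job j s) j) = slack * real (snd s j) - slack"
          using busy by (simp add: remove_job_def of_nat_diff algebra_simps)
        thus ?thesis using slack by (auto simp: H_def delay_to_def remove_job_def)
      qed
      hence "2 * (W - w) * delay_to (remove_job j s) j \<le> 2 * (W - w) * (H + slack)"
        using workload_nonneg[of "remove_job j s"] by (intro mult_left_mono) (auto simp: W')
      moreover have "w * H \<ge> 0" "w * slack \<ge> 0" using w H slack by auto
      ultimately have "U (remove_job j s) - U s \<le> - 2 * W * w + w\<^sup>2 + 2 * slack * W"
        unfolding U_s(2) by (simp add: U_def W' power2_eq_square algebra_simps)
      hence "\<mu> j * (U (remove_job j s) - U s) \<le> \<mu> j * (- 2 * W * w + w\<^sup>2 + 2 * slack * W)"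
        using \<mu>_pos[OF j(1)] by (intro mult_left_mono) auto
      also have "\<dots> = - 2 * W * (\<mu> j * w) + (\<mu> j * w) * w + \<mu> j * (2 * slack * W)"
        by (simp add: power2_eq_square algebra_simps)
      also have "\<mu> j * (2 * slack * W) \<le> 1 * (2 * slack * W)"
        using \<mu>_le[OF j(1)] slack W by (intro mult_right_mono) auto
      finally have "\<mu> j * (U (remove_job j s) - U s) \<le> - 2 * W + w + (1 - \<rho>) * W"
        unfolding w(2) slack(2) by simp
      moreover have "j \<in> actions N s" "j \<notin> adjacent_nodes N s"
        using True by (auto simp: actions_def adjacent_nodes_def)
      ultimately show ?thesis
        using inv_le[OF j(1)] j(1) busy True by (intro reduce[of j]) (auto simp: w_def)
    qed
  qed
qed

section \<open>Emptying the system\<close>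

text \<open>
  The transitions that the server controls: switches along edges, and service completions. None of
  them increases the workload.
\<close>

definition emptying_moves :: "('v state \<times> 'v state) set" where
  "emptying_moves = {(s, t). s \<in> states N \<and>
     ((\<exists>w. (fst s, w) \<in> parcs (network N) \<and> t = (w, snd s)) \<or>
      (fst s \<in> demand_points N \<and> snd s (fst s) \<ge> 1 \<and> t = remove_job (fst s) s))}"

lemma emptying_moves_switch:
  assumes "(v, x) \<in> states N" and "w \<in> pverts (network N)"
  shows "((v, x), (w, x)) \<in> emptying_moves\<^sup>*"
proof -
  have v: "v \<in> pverts (network N)" using assms(1) by (simp add: states_def)
  have x: "x \<in> demand_points N \<rightarrow>\<^sub>E UNIV" using assms(1) by (simp add: states_def)
  have "u \<in> pverts (network N) \<and> ((v, x), (u, x)) \<in> emptying_moves\<^sup>*"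
    if "(v, u) \<in> (parcs (network N))\<^sup>*" for u
    using that
  proof induction
    case (step y u)
    have "((y, x), (u, x)) \<in> emptying_moves"
      using step x by (auto simp: emptying_moves_def states_def)
    moreover have "u \<in> pverts (network N)" using arc_adjacent(4)[of "(y, x)" u] step(2) by simp
    ultimately show ?case using step.IH by (blast intro: rtrancl_into_rtrancl)
  qed (use v in simp)
  thus ?thesis using nodes_reachable[OF v assms(2)] by blast
qed

lemma emptying_moves_reach_empty:
  assumes "s \<in> states N" and "v0 \<in> pverts (network N)"
  shows "(s, (v0, \<lambda>i\<in>demand_points N. 0)) \<in> emptying_moves\<^sup>*"
  using assms(1)
proof (induction "\<Sum>i\<in>demand_points N. snd s i" arbitrary: s rule: less_induct)
  case less
  obtain v x where s: "s = (v, x)" by (cases s)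
  show ?case
  proof (cases "\<exists>i\<in>demand_points N. x i \<ge> 1")
    case True
    then obtain i where i: "i \<in> demand_points N" "x i \<ge> 1" by blast
    have iv: "i \<in> pverts (network N)" using i(1) demand_points_subset by blast
    let ?t = "remove_job i (i, x)"
    have "(s, (i, x)) \<in> emptying_moves\<^sup>*"
      using less.prems iv unfolding s by (rule emptying_moves_switch)
    also have i_state: "(i, x) \<in> states N" using less.prems iv by (simp add: s states_def)
    hence "((i, x), ?t) \<in> emptying_moves"
      using i by (simp add: emptying_moves_def)
    also have t_state: "?t \<in> states N"
      using i_state i(1) by (auto simp: states_def remove_job_def PiE_iff extensional_def)
    have "(\<Sum>k\<in>demand_points N. snd ?t k) < (\<Sum>k\<in>demand_points N. snd s k)"
      using i finite_demand_points by (intro sum_strict_mono_ex1) (auto simp: remove_job_def s)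
    hence "(?t, (v0, \<lambda>i\<in>demand_points N. 0)) \<in> emptying_moves\<^sup>*"
      using t_state by (rule less.hyps)
    finally show ?thesis .
  next
    case False
    hence "x = (\<lambda>i\<in>demand_points N. 0)"
      using less.prems by (auto simp: s states_def fun_eq_iff restrict_def PiE_iff extensional_def)
    thus ?thesis using emptying_moves_switch[OF less.prems[unfolded s] assms(2)] by (simp add: s)
  qed
qed

definition min_rate :: real where
  "min_rate = Min (insert (switch_rate N) (service_rate N ` demand_points N))"

lemma min_rate_pos: "min_rate > 0"
  and min_rate_le_switch_rate: "min_rate \<le> switch_rate N"
  and min_rate_le_service_rate: "i \<in> demand_points N \<Longrightarrow> min_rate \<le> service_rate N i"
  unfolding min_rate_def using finite_demand_points switch_rate_pos service_rate_pos by auto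

text \<open>Each of these transitions has probability at least \<open>min_rate\<close> under a suitable action.\<close>

lemma emptying_move_prob:
  assumes "(s, t) \<in> emptying_moves"
  obtains a where "a \<in> actions N s" and "pmf (transition N s a) t \<ge> min_rate"
    and "t \<in> states N" and "workload t \<le> workload s"
proof -
  have s: "s \<in> states N" using assms by (simp add: emptying_moves_def)
  have arrivals: "(\<Sum>i | i \<in> demand_points N \<and> t = add_job i s. arrival_rate N i) \<ge> 0"
    using arrival_rate_pos by (intro sum_nonneg) (auto intro: less_imp_le)
  from assms consider
      (switch) w where "(fst s, w) \<in> parcs (network N)" "t = (w, snd s)"
    | (serve) "fst s \<in> demand_points N" "snd s (fst s) \<ge> 1" "t = remove_job (fst s) s"
    by (auto simp: emptying_moves_def)
  thus thesis
  proof cases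
    case switch
    note w = arc_adjacent[OF switch(1)]
    have "t \<noteq> s" using w(3) switch(2) by (metis fst_conv)
    hence "pmf (transition N s w) t \<ge> switch_rate N"
      using arrivals w switch(2)
      by (simp add: pmf_transition[OF s w(2)] transition_prob_def move_prob_def)
    thus thesis
      using that[of w] w s min_rate_le_switch_rate
      by (auto simp: switch(2) workload_switch states_def)
  next
    case serve
    let ?a = "fst s"
    have a: "?a \<in> actions N s" by (simp add: actions_def)
    have "snd t ?a \<noteq> snd s ?a" using serve by (simp add: remove_job_def)
    hence "t \<noteq> s" by metis
    hence "pmf (transition N s ?a) t \<ge> service_rate N ?a"
      using arrivals serve
      by (simp add: pmf_transition[OF s a] transition_prob_def move_prob_def adjacent_nodes_def)
    moreover have "t \<in> states N"
      using s serve by (auto simp: states_def remove_job_def PiE_iff extensional_def)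
    moreover have "workload t \<le> workload s"
      using workload_remove_job[OF serve(1,2)] serve(3) service_rate_pos[OF serve(1)] by simp
    ultimately show thesis
      using that[OF a] min_rate_le_service_rate[OF serve(1)] by linarith
  qed
qed

lemma finite_bounded_workload: "finite {s \<in> states N. workload s \<le> W0}"
proof -
  interpret G: pair_graph "network N" by (rule graph)
  let ?X = "PiE (demand_points N) (\<lambda>i. {.. nat \<lfloor>W0 * service_rate N i\<rfloor>})"
  have "snd s i \<le> nat \<lfloor>W0 * service_rate N i\<rfloor>"
    if "workload s \<le> W0" and i: "i \<in> demand_points N" for s i
  proof -
    have "real (snd s i) / service_rate N i \<le> workload s"
      unfolding workload_def using i finite_demand_points service_rate_pos
      by (intro member_le_sum) (auto intro!: divide_nonneg_pos)
    hence "real (snd s i) / service_rate N i \<le> W0" using that(1) by simp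
    hence "real (snd s i) \<le> W0 * service_rate N i"
      using service_rate_pos[OF i] by (simp add: pos_divide_le_eq)
    thus ?thesis by linarith
  qed
  hence "{s \<in> states N. workload s \<le> W0} \<subseteq> pverts (network N) \<times> ?X"
    by (auto simp: states_def PiE_iff)
  moreover have "finite (pverts (network N) \<times> ?X)"
    using G.pair_finite_verts finite_demand_points by (intro finite_cartesian_product finite_PiE) auto
  ultimately show ?thesis by (rule finite_subset)
qed

lemma finite_actions: "finite (actions N s)"
proof -
  interpret G: pair_graph "network N" by (rule graph)
  have "actions N s \<subseteq> insert (fst s) (pverts (network N))"
    using arc_adjacent(4) by (auto simp: actions_def adjacent_nodes_def)
  thus ?thesis using G.pair_finite_verts by (meson finite_insert finite_subset)
qed

text \<open>
  On the finite set of states with workload at most \<open>W0\<close>, let \<open>\<psi> s = \<gamma> ^ l\<close>, where \<open>l\<close> is the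
  number of emptying moves needed to reach \<open>z\<close>. A step that reduces \<open>l\<close> has probability at least
  \<open>min_rate = 2 \<gamma>\<close> and multiplies \<open>\<psi>\<close> by \<open>1 / \<gamma>\<close>, so the mean of \<open>\<psi>\<close> at least doubles. Since \<open>\<psi>\<close>
  attains its minimum \<open>0\<close> outside this set, its mean cannot decrease there, whatever the action.
\<close>

lemma emptying_potential:
  assumes z: "z = (v0, \<lambda>i\<in>demand_points N. 0)" and v0: "v0 \<in> pverts (network N)"
  obtains \<psi> :: "'v state \<Rightarrow> real" and \<eta> :: real where "\<eta> > 0" and "\<forall>s. 0 \<le> \<psi> s \<and> \<psi> s \<le> 1"
    and "\<forall>s. workload s > W0 \<longrightarrow> \<psi> s = 0"
    and "\<forall>s\<in>states N - {z}. workload s \<le> W0 \<longrightarrow>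
      (\<exists>a\<in>actions N s. measure_pmf.expectation (transition N s a) \<psi> \<ge> \<psi> s + \<eta>)"
proof -
  define C where "C = {s \<in> states N. workload s \<le> W0}"
  define \<gamma> where "\<gamma> = min_rate / 2"
  define len where "len s = hops emptying_moves s z" for s
  define \<psi> where "\<psi> s = (if s \<in> C then \<gamma> ^ len s else 0)" for s
  have \<gamma>: "0 < \<gamma>" "\<gamma> \<le> 1"
    using min_rate_pos min_rate_le_switch_rate switch_rate_le_1 by (auto simp: \<gamma>_def)
  have finC: "finite C" unfolding C_def by (rule finite_bounded_workload)
  define \<eta> where "\<eta> = Min (insert 1 (\<psi> ` C))"
  have \<eta>: "\<eta> > 0" using finC \<gamma>(1) by (auto simp: \<eta>_def \<psi>_def)
  have \<eta>_le: "\<eta> \<le> \<psi> s" if "s \<in> C" for s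
    unfolding \<eta>_def using finC that by (intro Min_le) auto
  have \<psi>_bounds: "0 \<le> \<psi> s" "\<psi> s \<le> 1" for s
    using \<gamma> by (auto simp: \<psi>_def power_le_one)
  show thesis
  proof (rule that[where \<psi> = \<psi> and \<eta> = \<eta>], safe)
    fix s assume s: "s \<in> states N" and small: "workload s \<le> W0" and "s \<noteq> z"
    have sC: "s \<in> C" using s small by (simp add: C_def)
    obtain t where t: "(s, t) \<in> emptying_moves" "len s = Suc (len t)"
      unfolding len_def
      using hops_step[OF emptying_moves_reach_empty[OF s v0, folded z] \<open>s \<noteq> z\<close>] by blast
    obtain a where a: "a \<in> actions N s" "pmf (transition N s a) t \<ge> min_rate"
      "t \<in> states N" "workload t \<le> workload s"
      using emptying_move_prob[OF t(1)] by blast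
    have tC: "t \<in> C" using a(3,4) small by (simp add: C_def)
    have "\<psi> s + \<eta> \<le> 2 * \<psi> s" using \<eta>_le[OF sC] by simp
    also have "\<dots> = \<psi> t * min_rate" using sC tC by (simp add: \<psi>_def t(2) \<gamma>_def)
    also have "\<dots> \<le> \<psi> t * pmf (transition N s a) t"
      using a(2) \<psi>_bounds by (intro mult_left_mono)
    also have "\<dots> = measure_pmf.expectation (transition N s a) (\<lambda>u. if u = t then \<psi> t else 0)"
      by (subst integral_measure_pmf_real[where A = "{t}"]) (auto split: if_splits)
    also have "\<dots> \<le> measure_pmf.expectation (transition N s a) \<psi>"
      using s a(1) \<psi>_bounds by (intro expectation_mono) auto
    finally show "\<exists>a\<in>actions N s. measure_pmf.expectation (transition N s a) \<psi> \<ge> \<psi> s + \<eta>"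
      using a(1) by blast
  qed (use \<eta> \<psi>_bounds in \<open>auto simp: \<psi>_def C_def\<close>)
qed

text \<open>
  The multiple \<open>\<kappa>\<close> makes the drift of the energy outweigh the cost when the workload is above \<open>W0\<close>;
  the multiple \<open>M\<close> makes the drift of \<open>\<psi>\<close> outweigh all other terms on the finite rest. As \<open>\<psi>\<close> vanishes
  above \<open>W0\<close>, the choice of \<open>M\<close> does not interfere with that of \<open>W0\<close>.
\<close>

theorem exists_lyapunov_function:
  assumes stable: "traffic_intensity N < 1"
  obtains z V where "z \<in> states N" and "\<forall>s. V s \<ge> 0"
    and "\<forall>s\<in>states N - {z}.
      \<exists>a\<in>actions N s. step_cost N s + 1 + measure_pmf.expectation (transition N s a) V \<le> V s"
proof -
  define \<rho> where "\<rho> = traffic_intensity N"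
  have \<rho>: "\<rho> < 1" using stable by (simp add: \<rho>_def)
  obtain v0 where v0: "v0 \<in> pverts (network N)" using nodes_nonempty by blast
  define z where "z = (v0, \<lambda>i\<in>demand_points N. 0 :: nat)"
  obtain W1 B where drift: "\<forall>s\<in>states N. workload s > W1 \<longrightarrow>
    (\<exists>a\<in>actions N s. measure_pmf.expectation (transition N s a) energy
      \<le> energy s - (1 - \<rho>) * workload s + B)"
    unfolding \<rho>_def by (rule energy_drift[OF stable])
  define c where "c = (\<Sum>i\<in>demand_points N. holding_cost N i * service_rate N i)"
  have c: "c \<ge> 0" unfolding c_def
    using holding_cost_pos service_rate_pos by (intro sum_nonneg) (auto intro: less_imp_le)
  have cost_le: "step_cost N s \<le> c * workload s" for s
    unfolding c_def by (rule step_cost_le_workload)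
  define \<kappa> where "\<kappa> = (c + 1) / (1 - \<rho>)"
  have \<kappa>: "\<kappa> \<ge> 0" "\<kappa> * (1 - \<rho>) = c + 1" using c \<rho> by (auto simp: \<kappa>_def)
  define W0 where "W0 = max W1 (1 + \<kappa> * B)"
  obtain \<psi> :: "'v state \<Rightarrow> real" and \<eta> :: real where \<eta>: "\<eta> > 0" and \<psi>_bounds: "\<forall>s. 0 \<le> \<psi> s \<and> \<psi> s \<le> 1"
    and \<psi>_large: "\<forall>s. workload s > W0 \<longrightarrow> \<psi> s = 0"
    and \<psi>_drift: "\<forall>s\<in>states N - {z}. workload s \<le> W0 \<longrightarrow>
      (\<exists>a\<in>actions N s. measure_pmf.expectation (transition N s a) \<psi> \<ge> \<psi> s + \<eta>)"
    by (rule emptying_potential[OF z_def v0, where ?W0.0 = W0])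
  have \<psi>: "0 \<le> \<psi> s" "\<psi> s \<le> 1" for s using \<psi>_bounds by blast+
  let ?E = "\<lambda>s a. measure_pmf.expectation (transition N s a)"
  define C where "C = (SIGMA s : {s \<in> states N. workload s \<le> W0}. actions N s)"
  have "finite C" unfolding C_def
    by (intro finite_SigmaI finite_bounded_workload finite_actions)
  hence "bdd_above ((\<lambda>(s, a). step_cost N s + 1 + \<kappa> * ?E s a energy) ` C)"
    by (intro bdd_above_finite finite_imageI)
  then obtain b where ub: "\<forall>p\<in>C. (case p of (s, a) \<Rightarrow> step_cost N s + 1 + \<kappa> * ?E s a energy) \<le> b"
    by (auto simp: bdd_above_def)
  have b: "step_cost N s + 1 + \<kappa> * ?E s a energy \<le> b" if "(s, a) \<in> C" for s a
    using bspec[OF ub that] by simp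
  define M where "M = max b 0 / \<eta>"
  have M: "M \<ge> 0" "M * \<eta> \<ge> b" using \<eta> by (auto simp: M_def)
  define V where "V s = \<kappa> * energy s + M * (1 - \<psi> s)" for s
  have E_V: "?E s a V = \<kappa> * ?E s a energy + M * (1 - ?E s a \<psi>)"
    if "s \<in> states N" "a \<in> actions N s" for s a
  proof -
    note int = integrable_measure_pmf_finite[OF finite_set_transition[OF that]]
    show ?thesis unfolding V_def
      by (subst Bochner_Integration.integral_add) (simp_all add: int)
  qed
  show thesis
  proof (rule that[of z V])
    show "z \<in> states N" using v0 by (auto simp: z_def states_def)
    show "\<forall>s. V s \<ge> 0"
    proof
      fix s
      show "V s \<ge> 0" unfolding V_def using \<kappa>(1) energy_nonneg[of s] M(1) \<psi>(2)[of s] by simp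
    qed
  next
    show "\<forall>s\<in>states N - {z}. \<exists>a\<in>actions N s. step_cost N s + 1 + ?E s a V \<le> V s"
    proof
      fix s assume "s \<in> states N - {z}"
      hence s: "s \<in> states N" and "s \<noteq> z" by auto
      show "\<exists>a\<in>actions N s. step_cost N s + 1 + ?E s a V \<le> V s"
      proof (cases "workload s \<le> W0")
        case True
        obtain a where a: "a \<in> actions N s" "?E s a \<psi> \<ge> \<psi> s + \<eta>"
          using \<psi>_drift s True \<open>s \<noteq> z\<close> by blast
        have "M * (1 - ?E s a \<psi>) \<le> M * (1 - \<psi> s - \<eta>)"
          using a(2) M(1) by (intro mult_left_mono) auto
        hence "M * (1 - ?E s a \<psi>) \<le> M * (1 - \<psi> s) - b"
          using M(2) by (simp add: algebra_simps)
        moreover have "step_cost N s + 1 + \<kappa> * ?E s a energy \<le> b"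
          using s True a(1) by (intro b) (simp add: C_def)
        moreover have "\<kappa> * energy s \<ge> 0" using \<kappa>(1) energy_nonneg by simp
        ultimately have "step_cost N s + 1 + ?E s a V \<le> V s"
          unfolding E_V[OF s a(1)] by (simp add: V_def)
        thus ?thesis using a(1) by blast
      next
        case False
        hence large: "workload s > W1" "workload s > 1 + \<kappa> * B" by (auto simp: W0_def)
        obtain a where a: "a \<in> actions N s"
          "?E s a energy \<le> energy s - (1 - \<rho>) * workload s + B"
          using drift s large(1) by blast
        have "\<kappa> * ?E s a energy \<le> \<kappa> * (energy s - (1 - \<rho>) * workload s + B)"
          using a(2) \<kappa>(1) by (rule mult_left_mono)
        also have "\<dots> = \<kappa> * energy s - (\<kappa> * (1 - \<rho>)) * workload s + \<kappa> * B"
          by (simp add: algebra_simps)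
        also have "\<dots> = \<kappa> * energy s - c * workload s - workload s + \<kappa> * B"
          unfolding \<kappa>(2) by (simp add: algebra_simps)
        finally have energy_part: "step_cost N s + 1 + \<kappa> * ?E s a energy \<le> \<kappa> * energy s"
          using cost_le[of s] large(2) by linarith
        have "?E s a \<psi> \<ge> 0" using \<psi>(1) by (intro Bochner_Integration.integral_nonneg) auto
        moreover have "\<psi> s = 0" using \<psi>_large False by (metis not_le)
        ultimately have "M * (1 - ?E s a \<psi>) \<le> M * (1 - \<psi> s)"
          using M(1) by (intro mult_left_mono) auto
        hence "step_cost N s + 1 + ?E s a V \<le> V s"
          using energy_part unfolding E_V[OF s a(1)] by (simp add: V_def)
        thus ?thesis using a(1) by blast
      qed
    qed
  qed
qed

section \<open>The stationary policy\<close>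

lemma step_cost_nonneg: "step_cost N s \<ge> 0"
  unfolding step_cost_def using holding_cost_pos
  by (intro sum_nonneg mult_nonneg_nonneg) (auto intro: less_imp_le)

lemma expected_total_cost_Suc:
  "expected_total_cost N \<theta> (Suc T) s = ennreal (step_cost N s)
     + (\<integral>\<^sup>+ t. expected_total_cost N \<theta> T t \<partial>measure_pmf (transition N s (\<theta> s)))"
proof -
  have "ennreal (\<Sum>t<Suc T. step_cost N ((s # xs) ! t))
      = ennreal (step_cost N s) + ennreal (\<Sum>t<T. step_cost N (xs ! t))" for xs
    unfolding sum.lessThan_Suc_shift
    using step_cost_nonneg by (simp add: sum_nonneg)
  thus ?thesis
    by (simp add: expected_total_cost_def nn_integral_add del: sum.lessThan_Suc)
qed

end

theorem theorem2p2:
  fixes N :: "'v server_network"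
  assumes "uniformized_server_network N"
    and "traffic_intensity N < 1"
  shows "\<exists>\<theta>. deterministic_stationary_policy N \<theta> \<and>
           (\<exists>g :: ennreal. g < \<infinity> \<and> (\<forall>s\<in>states N. average_cost N \<theta> s = g))"
proof -
  interpret uniformized_server_network N by (rule assms(1))
  obtain z V where z: "z \<in> states N" and V_nonneg: "\<forall>s. V s \<ge> 0"
    and "\<forall>s\<in>states N - {z}.
      \<exists>a\<in>actions N s. step_cost N s + 1 + measure_pmf.expectation (transition N s a) V \<le> V s"
    by (rule exists_lyapunov_function[OF assms(2)])
  note V = V_nonneg[rule_format]
  note \<open>\<forall>s\<in>states N - {z}. _\<close>
  moreover have "fst s \<in> actions N s" for s by (simp add: actions_def)
  ultimately have "\<forall>s\<in>states N. \<exists>a. a \<in> actions N s \<and> (s \<noteq> z \<longrightarrow>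
      step_cost N s + 1 + measure_pmf.expectation (transition N s a) V \<le> V s)"
    by blast
  from bchoice[OF this] obtain \<theta> where "\<forall>s\<in>states N. \<theta> s \<in> actions N s \<and> (s \<noteq> z \<longrightarrow>
      step_cost N s + 1 + measure_pmf.expectation (transition N s (\<theta> s)) V \<le> V s)"
    by blast
  hence \<theta>: "\<And>s. s \<in> states N \<Longrightarrow> \<theta> s \<in> actions N s"
    and drift: "\<And>s. s \<in> states N \<Longrightarrow> s \<noteq> z \<Longrightarrow>
      step_cost N s + 1 + measure_pmf.expectation (transition N s (\<theta> s)) V \<le> V s"
    by auto
  define K where "K s = transition N s (\<theta> s)" for s
  interpret cost_chain K "\<lambda>s. ennreal (step_cost N s)" "states N"
    by unfold_locales (use transition_closed[OF _ \<theta>] in \<open>auto simp: K_def\<close>)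
  have total_eq: "total T s = expected_total_cost N \<theta> T s" for T s
  proof (induction T arbitrary: s)
    case 0
    show ?case by (simp add: expected_total_cost_def)
  next
    case (Suc T)
    show ?case by (simp add: Suc expected_total_cost_Suc flip: K_def)
  qed
  have E_V: "(\<integral>\<^sup>+ t. ennreal (V t) \<partial>measure_pmf (K s))
      = ennreal (measure_pmf.expectation (transition N s (\<theta> s)) V)" if s: "s \<in> states N" for s
  proof -
    have "finite (set_pmf (K s))"
      unfolding K_def using s \<theta>[OF s] by (rule finite_set_transition)
    thus ?thesis unfolding K_def[symmetric]
      using V by (intro nn_integral_eq_integral integrable_measure_pmf_finite) auto
  qed
  have drift': "ennreal (step_cost N s) + 1 + (\<integral>\<^sup>+ t. ennreal (V t) \<partial>measure_pmf (K s)) \<le> ennreal (V s)"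
    if "s \<in> states N" "s \<noteq> z" for s
  proof -
    have "measure_pmf.expectation (transition N s (\<theta> s)) V \<ge> 0"
      using V by (intro Bochner_Integration.integral_nonneg) auto
    hence "ennreal (step_cost N s) + 1 + (\<integral>\<^sup>+ t. ennreal (V t) \<partial>measure_pmf (K s))
        = ennreal (step_cost N s + 1 + measure_pmf.expectation (transition N s (\<theta> s)) V)"
      using step_cost_nonneg by (simp add: E_V[OF that(1)])
    also have "\<dots> \<le> ennreal (V s)" using drift[OF that] by (rule ennreal_leI)
    finally show ?thesis .
  qed
  let ?b = "ennreal (step_cost N z) + (\<integral>\<^sup>+ t. ennreal (V t) \<partial>measure_pmf (K z))"
  have b: "?b < \<infinity>" by (simp add: E_V[OF z])
  have drift_z: "?b \<le> ennreal (V z) + ?b" by (rule le_iff_add[THEN iffD2]) (auto simp: add.commute)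
  note const = average_cost_constant[OF z b _ drift' drift_z, simplified total_eq]
  show ?thesis
  proof (intro exI conjI ballI)
    show "deterministic_stationary_policy N \<theta>"
      using \<theta> by (simp add: deterministic_stationary_policy_def)
    show "average_cost N \<theta> z < \<infinity>"
      using const(1) by (simp add: average_cost_def)
    show "average_cost N \<theta> s = average_cost N \<theta> z" if "s \<in> states N" for s
      using const(2) that by (simp add: average_cost_def)
  qed
qed

end
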